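(* Let $A$ be a unital complex Banach algebra and let $a,b\in A$. Then $$\sigma_{\mathcal{DR}}(ab)=\sigma_{\mathcal{DR}}(ba).$$
   Context: Let $A$ be a unital complex Banach algebra with unit $e$; $c-\lambda$ means $c-\lambda e$. An element $c\in A$ is Drazin invertible if there exist $d\in A$ and $m\in\mathbb N$ such that $c^mdc=c^m$, $dcd=d$ and $cd=dc$. The Drazin spectrum of $c\in A$ is $\sigma_{\mathcal{DR}}(c)=\{\lambda\in\mathbb C: c-\lambda \text{ is not Drazin invertible in } A\}$. *)

theory Defs
  imports "HOL-Analysis.Analysis"
begin

text \<open>The distribution only has real Banach algebras; the complex scalar multiplication is added
  so that it restricts to the real one. Neither \<open>norm 1 = 1\<close> nor \<open>1 \<noteq> 0\<close> is required of the unit;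
  requiring them would only narrow the class.\<close>

class complex_banach_algebra_unital = real_normed_algebra + monoid_mult + banach +
  fixes scaleC :: "complex \<Rightarrow> 'a \<Rightarrow> 'a"  (infixr \<open>*\<^sub>C\<close> 75)
  assumes scaleC_add_right: "x *\<^sub>C (u + v) = x *\<^sub>C u + x *\<^sub>C v"
    and scaleC_add_left: "(x + y) *\<^sub>C u = x *\<^sub>C u + y *\<^sub>C u"
    and scaleC_scaleC: "x *\<^sub>C y *\<^sub>C u = (x * y) *\<^sub>C u"
    and scaleC_one: "1 *\<^sub>C u = u"
    and scaleC_of_real: "complex_of_real r *\<^sub>C u = r *\<^sub>R u"
    and mult_scaleC_left: "(x *\<^sub>C u) * v = x *\<^sub>C (u * v)"
    and mult_scaleC_right: "u * (x *\<^sub>C v) = x *\<^sub>C (u * v)"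
    and norm_scaleC: "norm (x *\<^sub>C u) = cmod x * norm u"

text \<open>Allowing \<open>m = 0\<close> does no harm: it says that \<open>d\<close> is a two-sided inverse of \<open>c\<close>,
  and then \<open>m = 1\<close> works as well.\<close>

definition drazin_invertible :: "'a::monoid_mult \<Rightarrow> bool" where
  "drazin_invertible c \<longleftrightarrow>
     (\<exists>d. \<exists>m::nat. c ^ m * d * c = c ^ m \<and> d * c * d = d \<and> c * d = d * c)"

definition drazin_spectrum :: "'a::complex_banach_algebra_unital \<Rightarrow> complex set" where
  "drazin_spectrum c = {z. \<not> drazin_invertible (c - z *\<^sub>C 1)}"

end

theory Submission
  imports Defs
begin

text \<open>Put \<open>c = a b - z\<close> and \<open>c' = b a - z\<close>. By symmetry it is enough to carry Drazin invertibility
  from \<open>c\<close> to \<open>c'\<close>.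

  The identity \<open>d c d = d\<close> in the definition can always be arranged afterwards:
  \<open>drazin_invertible_iff_commuting\<close> shows that \<open>c\<close> is Drazin invertible as soon as some \<open>x\<close>
  commuting with \<open>c\<close> satisfies \<open>c\<^bsup>m+1\<^esup> x = c\<^bsup>m\<^esup>\<close>. Such an \<open>x\<close> is easy to transport, because \<open>a\<close> and
  \<open>b\<close> intertwine the two elements: \<open>c' b = b c\<close> and \<open>a c' = c a\<close>. Hence \<open>y \<mapsto> b y a\<close> sends elements
  commuting with \<open>c\<close> to elements commuting with \<open>c'\<close>, and \<open>c'\<^bsup>n\<^esup> b y a = b c\<^bsup>n\<^esup> y a\<close>.

  If \<open>z = 0\<close>, then \<open>c' = b a\<close>, and \<open>b x\<^sup>2 a\<close> works for \<open>c'\<close> with exponent \<open>m + 1\<close>; this is the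
  existence part of Cline's formula. If \<open>z \<noteq> 0\<close>, then \<open>z c'\<^bsup>m\<^esup> = c'\<^bsup>m\<^esup> (b a - c')\<close>, where
  \<open>c'\<^bsup>m\<^esup> b a = b c\<^bsup>m\<^esup> a = b c\<^bsup>m+1\<^esup> x a = c'\<^bsup>m+1\<^esup> b x a\<close>; so \<open>z c'\<^bsup>m\<^esup> = c'\<^bsup>m+1\<^esup> (b x a - 1)\<close>, and it
  remains to divide by \<open>z\<close>. This is Jacobson's lemma for the Drazin inverse.\<close>

lemma power_Suc_mult_imp_power_add_mult:
  fixes c x :: "'a::monoid_mult"
  assumes "c ^ Suc m * x = c ^ m"
  shows "c ^ (m + k) * x ^ k = c ^ m"
proof (induction k)
  case 0
  then show ?case by simp
next
  case (Suc k)
  have "m + Suc k = k + Suc m"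
    by simp
  then have "c ^ (m + Suc k) * x ^ Suc k = c ^ k * (c ^ Suc m * x) * x ^ k"
    by (simp only: power_add[of c k "Suc m"] power_Suc[of x] mult.assoc)
  also have "\<dots> = c ^ (m + k) * x ^ k"
    by (simp only: assms) (simp add: add.commute flip: power_add)
  finally show ?case
    using Suc.IH by simp
qed

text \<open>Cutting \<open>x\<close> down to \<open>c\<^bsup>m\<^esup> x\<^bsup>m+1\<^esup>\<close> produces the Drazin inverse: powers of \<open>c\<close> above the \<open>m\<close>-th
  cancel against powers of \<open>x\<close>, and all factors commute.\<close>

lemma drazin_invertible_iff_commuting:
  fixes c :: "'a::monoid_mult"
  shows "drazin_invertible c \<longleftrightarrow> (\<exists>x m. c * x = x * c \<and> c ^ Suc m * x = c ^ m)"
proof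
  assume "drazin_invertible c"
  then obtain d m where "c ^ m * d * c = c ^ m" "c * d = d * c"
    unfolding drazin_invertible_def by blast
  then have "c ^ Suc m * d = c ^ m"
    by (metis mult.assoc power_Suc2)
  with \<open>c * d = d * c\<close> show "\<exists>x m. c * x = x * c \<and> c ^ Suc m * x = c ^ m"
    by blast
next
  assume "\<exists>x m. c * x = x * c \<and> c ^ Suc m * x = c ^ m"
  then obtain x m where comm: "c * x = x * c" and reg: "c ^ Suc m * x = c ^ m"
    by blast
  define d where "d = c ^ m * x ^ Suc m"
  have comm_power: "x ^ i * c ^ j = c ^ j * x ^ i" for i j
    by (metis comm power_commuting_commutes)
  have cancel: "c ^ (m + k) * x ^ k = c ^ m" for k
    using reg by (rule power_Suc_mult_imp_power_add_mult)
  have dc: "d * c = c ^ Suc m * x ^ Suc m"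
    unfolding d_def using comm_power[of "Suc m" 1]
    by (metis mult.assoc power_Suc2 power_one_right)
  have cd: "c * d = c ^ Suc m * x ^ Suc m"
    by (simp add: d_def mult.assoc)
  have "c ^ m * d * c = c ^ m * (c ^ Suc m * x ^ Suc m)"
    by (simp only: mult.assoc dc)
  also have "\<dots> = c ^ (m + Suc m) * x ^ Suc m"
    by (simp only: power_add mult.assoc)
  finally have "c ^ m * d * c = c ^ m"
    by (simp only: cancel)
  moreover have "d * c * d = d"
  proof -
    have "d * c * d = c ^ Suc m * (x ^ Suc m * c ^ m) * x ^ Suc m"
      by (simp only: dc) (simp only: d_def mult.assoc)
    also have "\<dots> = c ^ (m + Suc m) * x ^ Suc m * x ^ Suc m"
      by (simp only: comm_power add.commute[of m] power_add mult.assoc)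
    also have "\<dots> = d"
      by (simp only: cancel d_def)
    finally show ?thesis .
  qed
  ultimately show "drazin_invertible c"
    unfolding drazin_invertible_def using cd dc by metis
qed

lemma power_intertwine:
  fixes b c c' :: "'a::monoid_mult"
  assumes "c' * b = b * c"
  shows "c' ^ n * b = b * c ^ n"
proof (induction n)
  case 0
  then show ?case by simp
next
  case (Suc n)
  then show ?case
    by (metis assms mult.assoc power_Suc)
qed

lemma sandwich_commute:
  fixes a b c c' y :: "'a::monoid_mult"
  assumes "c' * b = b * c" and "a * c' = c * a" and "c * y = y * c"
  shows "c' * (b * y * a) = b * y * a * c'"
  by (metis assms mult.assoc)

text \<open>The case \<open>z = 0\<close>. One power of \<open>b a\<close> is spent on producing the outer factors \<open>b\<close> and \<open>a\<close>,
  so the exponent goes up by one, and \<open>x\<close> has to be used twice to pay for it.\<close>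

lemma drazin_invertible_mult_commute:
  fixes a b :: "'a::monoid_mult"
  assumes "drazin_invertible (a * b)"
  shows "drazin_invertible (b * a)"
proof -
  obtain x m where comm: "a * b * x = x * (a * b)"
    and reg: "(a * b) ^ Suc m * x = (a * b) ^ m"
    using assms unfolding drazin_invertible_iff_commuting by blast
  have b: "(b * a) ^ n * b = b * (a * b) ^ n" for n
    by (rule power_intertwine) (simp add: mult.assoc)
  have "a * b * x ^ 2 = x ^ 2 * (a * b)"
    using comm by (metis power_commuting_commutes)
  then have "b * a * (b * x ^ 2 * a) = b * x ^ 2 * a * (b * a)"
    by (intro sandwich_commute[where c = "a * b"]) (simp_all add: mult.assoc)
  moreover have "(b * a) ^ Suc (Suc m) * (b * x ^ 2 * a) = (b * a) ^ Suc m"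
  proof -
    have "(b * a) ^ Suc (Suc m) * (b * x ^ 2 * a) = b * ((a * b) ^ (m + 2) * x ^ 2) * a"
      using b[of "Suc (Suc m)"] by (metis add_2_eq_Suc' mult.assoc)
    also have "\<dots> = b * (a * b) ^ m * a"
      by (simp only: power_Suc_mult_imp_power_add_mult[OF reg])
    also have "\<dots> = (b * a) ^ Suc m"
      by (metis b mult.assoc power_Suc2)
    finally show ?thesis .
  qed
  ultimately show ?thesis
    unfolding drazin_invertible_iff_commuting by blast
qed

text \<open>The case \<open>z \<noteq> 0\<close>. Here \<open>z\<close> itself, written as \<open>b a - c'\<close>, supplies the factors \<open>b\<close> and \<open>a\<close>,
  so the exponent stays the same.\<close>

lemma drazin_invertible_mult_diff_commute:
  fixes a b :: "'a::complex_banach_algebra_unital"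
  assumes "z \<noteq> 0" and "drazin_invertible (a * b - z *\<^sub>C 1)"
  shows "drazin_invertible (b * a - z *\<^sub>C 1)"
proof -
  define c where "c = a * b - z *\<^sub>C 1"
  define c' where "c' = b * a - z *\<^sub>C 1"
  obtain x m where comm: "c * x = x * c" and reg: "c ^ Suc m * x = c ^ m"
    using assms(2) unfolding drazin_invertible_iff_commuting c_def by blast
  have cb: "c' * b = b * c" and ac: "a * c' = c * a"
    by (simp_all add: c_def c'_def algebra_simps mult_scaleC_left mult_scaleC_right)
  define v where "v = b * x * a - 1"
  have "c' * v = v * c'"
    using sandwich_commute[OF cb ac comm] by (simp add: v_def algebra_simps)
  then have "c' * (inverse z *\<^sub>C v) = inverse z *\<^sub>C v * c'"
    by (simp add: mult_scaleC_left mult_scaleC_right)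
  moreover have "c' ^ Suc m * (inverse z *\<^sub>C v) = c' ^ m"
  proof -
    have "c' ^ Suc m * v = b * (c ^ Suc m * x) * a - c' ^ Suc m"
      using power_intertwine[OF cb, of "Suc m"]
      by (simp add: v_def right_diff_distrib del: power_Suc flip: mult.assoc)
    also have "\<dots> = c' ^ m * (b * a - c')"
      using power_intertwine[OF cb, of m]
      by (simp only: reg) (simp add: right_diff_distrib power_Suc2 del: power_Suc flip: mult.assoc)
    also have "\<dots> = z *\<^sub>C c' ^ m"
      by (simp add: c'_def mult_scaleC_right)
    finally show ?thesis
      using \<open>z \<noteq> 0\<close> by (simp add: mult_scaleC_right scaleC_scaleC scaleC_one)
  qed
  ultimately show ?thesis
    unfolding drazin_invertible_iff_commuting c'_def by blast
qed

theorem theorem2p3: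
  fixes a b :: "'a :: complex_banach_algebra_unital"
  shows "drazin_spectrum (a * b) = drazin_spectrum (b * a)"
proof -
  have zero: "0 *\<^sub>C u = 0" for u :: 'a
    using scaleC_of_real[of 0 u] by simp
  have "drazin_invertible (q * p - z *\<^sub>C 1)" if "drazin_invertible (p * q - z *\<^sub>C 1)"
    for p q :: 'a and z
    using that drazin_invertible_mult_commute[of p q] drazin_invertible_mult_diff_commute[of z p q]
    by (cases "z = 0") (simp_all add: zero)
  then show ?thesis
    unfolding drazin_spectrum_def by blast
qed

end
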